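(* For any nonnegative integer $p$, $$\mathbb{J}(3)=\sum_{m+n=p}\ \sum_{|\boldsymbol{\alpha}|=n+3}\Bigl\{\zeta^\star(\alpha_1,\{1\}^m,\alpha_2+1)-\zeta(p+4)\Bigr\}\left(2^{\alpha_2-1}-1\right),$$ where $m,n$ run over nonnegative integers, $\boldsymbol{\alpha}=(\alpha_1,\alpha_2)$ runs over pairs of positive integers with $\alpha_1+\alpha_2=n+3$, and $$\mathbb{J}(3)=\frac1{p!}\int_{D_3}\left(\log\frac{1-t_1}{1-u_2}+\log\frac{t_2}{t_1}+\log\frac{u_2}{u_1}\right)^p\frac{dt_1\,dt_2}{(1-t_1)t_2}\frac{du_1\,du_2}{(1-u_1)u_2},$$ with $D_3=\{(t_1,t_2,u_1,u_2)\in\mathbb{R}^4: 0<t_1<u_1<t_2<u_2<1\}$.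
   Context: For an $r$-tuple $(\alpha_1,\ldots,\alpha_r)$ of positive integers with $\alpha_r\ge2$, the multiple zeta-star value is $\zeta^\star(\alpha_1,\ldots,\alpha_r)=\sum_{1\le k_1\le k_2\le\cdots\le k_r}k_1^{-\alpha_1}\cdots k_r^{-\alpha_r}$. $\zeta(s)$ with one argument is the Riemann zeta value. $\{1\}^m$ denotes $m$ repetitions of $1$. *)

theory Defs
  imports "HOL-Analysis.Analysis"
begin

definition zeta_value :: "nat \<Rightarrow> real" where
  "zeta_value s = (\<Sum>k. 1 / real (Suc k) ^ s)"

text \<open>
  The summation indices run over the weakly increasing sequences
  \<open>1 \<le> k\<^sub>1 \<le> \<dots> \<le> k\<^sub>r\<close>, where \<open>r\<close> is the length of the list of exponents.
  As usual for \<^const>\<open>infsum\<close>, the value is meaningful only for convergent sums,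
  in particular when all exponents are positive and the last one is at least 2.
\<close>
definition zeta_star :: "nat list \<Rightarrow> real" where
  "zeta_star \<alpha> =
     (\<Sum>\<^sub>\<infinity>ks | length ks = length \<alpha> \<and> sorted ks \<and> (\<forall>k\<in>set ks. 1 \<le> k).
        \<Prod>i<length \<alpha>. 1 / real (ks ! i) ^ (\<alpha> ! i))"

definition D3 :: "(real \<times> real \<times> real \<times> real) set" where
  "D3 = {(t1, t2, u1, u2). 0 < t1 \<and> t1 < u1 \<and> u1 < t2 \<and> t2 < u2 \<and> u2 < 1}"

definition J3 :: "nat \<Rightarrow> real" where
  "J3 p = 1 / fact p *
     (LINT (t1, t2, u1, u2):D3|lborel.
        (ln ((1 - t1) / (1 - u2)) + ln (t2 / t1) + ln (u2 / u1)) ^ p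
        * (1 / ((1 - t1) * t2)) * (1 / ((1 - u1) * u2)))"

end

theory Submission
  imports Defs "HOL-Complex_Analysis.Cauchy_Integral_Formula"
begin

text \<open>
  Both sides are the coefficients of \<open>x\<^sup>p\<close> in one and the same function
  \<open>G(x) = \<Sum>\<^bsub>1 \<le> k < l\<^esub> (\<Prod>\<^bsub>k \<le> j \<le> l\<^esub> j / (j - x)) / ((k - x) l (l - x) (l - 2x))\<close>.

  On the zeta-star side, an index sequence \<open>k \<le> \<dots> \<le> l\<close> of \<open>\<zeta>\<^sup>\<star>(\<alpha>\<^sub>1, {1}\<^sup>m, \<alpha>\<^sub>2 + 1)\<close> is grouped by its first and
  last entries. The middle entries sum to the complete homogeneous symmetric polynomial
  \<open>h\<^sub>m(1/k, \<dots>, 1/l)\<close>, and subtracting the zeta value removes the diagonal \<open>k = l\<close>. The sum over \<open>m\<close> gives the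
  product over \<open>j\<close>, the sum over \<open>\<alpha>\<^sub>1\<close> gives \<open>1/(k - x)\<close>, and the sum over \<open>\<alpha>\<^sub>2\<close> with the weights
  \<open>2\<^bsup>\<alpha>\<^sub>2 - 1\<^esup> - 1\<close> gives \<open>1/(l (l - x) (l - 2x))\<close> (lemmas \<open>zeta_star_minus_zeta\<close>, \<open>pair_coeff_sums\<close>, \<open>star_side_sums\<close>).

  On the integral side, summing over \<open>p\<close> turns the power of the logarithm into an exponential, so the
  integrand becomes a product of powers of \<open>t\<^sub>i\<close>, \<open>u\<^sub>i\<close>, \<open>1 - t\<^sub>1\<close>, \<open>1 - u\<^sub>1\<close>, \<open>1 - u\<^sub>2\<close>. The binomial series of
  \<open>(1 - t\<^sub>1)\<^bsup>x-1\<^esup>\<close> and the geometric series of \<open>1/(1 - u\<^sub>1)\<close> reduce the integrals over \<open>t\<^sub>1\<close>, \<open>t\<^sub>2\<close> and \<open>u\<^sub>1\<close> to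
  integrals of powers, and the one over \<open>u\<^sub>2\<close> is a Beta integral. The two summation indices are \<open>k - 1\<close>
  and \<open>l - k - 1\<close>, and the result is again \<open>G(x)\<close> (lemmas \<open>nn_integral_t1\<close>, \<open>nn_integral_u1\<close>, \<open>nn_integral_u2\<close>,
  \<open>J3_ennreal_generating\<close>).

  Everything in sight is nonnegative for \<open>0 < x \<le> 1/4\<close>, so all interchanges of sums and integrals are free
  once \<open>G(x)\<close> is known to be finite, which follows from a bound by a multiple of
  \<open>\<Sum> 1/(k\<^sup>2 l\<^sup>2)\<close>. Finally, two power series that agree on an interval to the right of 0 have the same
  coefficients (lemma \<open>power_series_zero_right\<close>).
\<close>

section \<open>Complete homogeneous symmetric polynomials in reciprocals\<close>

text \<open>
  The complete homogeneous symmetric polynomial \<open>h\<^sub>m(1/k, \<dots>, 1/l)\<close>. Its monomials are indexed by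
  sorted lists because that is the shape in which the string of ones of a zeta-star value
  supplies them.
\<close>

definition complete_hom :: "nat \<Rightarrow> nat \<Rightarrow> nat \<Rightarrow> real" where
  "complete_hom m k l = (\<Sum>xs | length xs = m \<and> sorted xs \<and> set xs \<subseteq> {k..l}. \<Prod>j\<leftarrow>xs. 1 / real j)"

lemma finite_sorted_lists: "finite {xs::nat list. length xs = m \<and> sorted xs \<and> set xs \<subseteq> {k..l}}"
  by (rule finite_subset[OF _ finite_lists_length_eq[of "{k..l}" m]]) auto

lemma complete_hom_nonneg: "complete_hom m k l \<ge> 0"
  unfolding complete_hom_def by (intro sum_nonneg prod_list_nonneg) auto

lemma complete_hom_0 [simp]: "complete_hom 0 k l = 1"
proof -
  have "{xs::nat list. length xs = 0 \<and> sorted xs \<and> set xs \<subseteq> {k..l}} = {[]}" by auto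
  thus ?thesis unfolding complete_hom_def by simp
qed

lemma complete_hom_Suc_empty: "l < k \<Longrightarrow> complete_hom (Suc m) k l = 0"
proof -
  assume "l < k"
  hence *: "{xs::nat list. length xs = Suc m \<and> sorted xs \<and> set xs \<subseteq> {k..l}} = {}"
    by (auto simp: length_Suc_conv)
  show ?thesis unfolding complete_hom_def * by simp
qed

text \<open>
  A sorted list over \<open>{k..l}\<close> either avoids \<open>k\<close> or starts with \<open>k\<close>.
\<close>

lemma complete_hom_Suc:
  assumes "k \<le> l"
  shows "complete_hom (Suc m) k l = complete_hom (Suc m) (Suc k) l + 1 / real k * complete_hom m k l"
proof -
  let ?S = "\<lambda>m k. {xs::nat list. length xs = m \<and> sorted xs \<and> set xs \<subseteq> {k..l}}"
  have split: "?S (Suc m) k = ?S (Suc m) (Suc k) \<union> (#) k ` ?S m k"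
  proof (intro equalityI subsetI)
    fix xs assume xs: "xs \<in> ?S (Suc m) k"
    then obtain y ys where ys: "xs = y # ys" by (auto simp: length_Suc_conv)
    show "xs \<in> ?S (Suc m) (Suc k) \<union> (#) k ` ?S m k"
    proof (cases "y = k")
      case True
      thus ?thesis using xs ys by auto
    next
      case False
      hence "Suc k \<le> y" using xs ys by auto
      thus ?thesis using xs ys by fastforce
    qed
  next
    fix xs assume "xs \<in> ?S (Suc m) (Suc k) \<union> (#) k ` ?S m k"
    thus "xs \<in> ?S (Suc m) k" using assms by (fastforce simp: Suc_le_eq)
  qed
  have disj: "?S (Suc m) (Suc k) \<inter> (#) k ` ?S m k = {}" by auto
  have "complete_hom (Suc m) k l = (\<Sum>xs\<in>?S (Suc m) (Suc k) \<union> (#) k ` ?S m k. \<Prod>j\<leftarrow>xs. 1 / real j)"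
    unfolding complete_hom_def split ..
  also have "\<dots> = complete_hom (Suc m) (Suc k) l + (\<Sum>xs\<in>(#) k ` ?S m k. \<Prod>j\<leftarrow>xs. 1 / real j)"
    unfolding complete_hom_def
    by (rule sum.union_disjoint) (use disj finite_sorted_lists in auto)
  also have "(\<Sum>xs\<in>(#) k ` ?S m k. \<Prod>j\<leftarrow>xs. 1 / real j) = (\<Sum>xs\<in>?S m k. 1 / real k * (\<Prod>j\<leftarrow>xs. 1 / real j))"
    by (subst sum.reindex) (auto simp: inj_on_def)
  also have "\<dots> = 1 / real k * complete_hom m k l"
    unfolding complete_hom_def sum_distrib_left ..
  finally show ?thesis .
qed

lemma complete_hom_diag: "complete_hom m k k = 1 / real k ^ m"
proof (induction m)
  case (Suc m)
  thus ?case by (simp add: complete_hom_Suc[of k k] complete_hom_Suc_empty)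
qed simp

text \<open>
  Iterating the previous recursion splits off the number \<open>i\<close> of leading entries \<open>k\<close>. In this form
  the generating functions multiply, one geometric series for each \<open>j\<close> between \<open>k\<close> and \<open>l\<close>.
\<close>

lemma complete_hom_convolution:
  assumes "k \<le> l"
  shows "complete_hom m k l = (\<Sum>i\<le>m. (1 / real k) ^ i * complete_hom (m - i) (Suc k) l)"
proof (induction m)
  case (Suc m)
  show ?case
    by (simp only: complete_hom_Suc[OF assms] Suc sum.atMost_Suc_shift)
       (simp add: sum_distrib_left mult.assoc)
qed simp

lemma nonneg_Cauchy_product_sums:
  fixes a b :: "nat \<Rightarrow> real"
  assumes "a sums A" "b sums B" "\<And>i. a i \<ge> 0" "\<And>i. b i \<ge> 0"
  shows "(\<lambda>n. \<Sum>i\<le>n. a i * b (n - i)) sums (A * B)"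
  using Cauchy_product_sums[of a b] assms by (simp add: sums_iff)

text \<open>
  The classical product formula \<open>\<Sum>\<^sub>m h\<^sub>m x\<^sup>m = \<Prod>\<^sub>j 1 / (1 - x / j)\<close>. Induction on the length of the
  interval, so that convergence comes along with the value.
\<close>

lemma complete_hom_sums:
  fixes x :: real
  assumes "0 \<le> x" "x < 1" "1 \<le> k"
  shows "(\<lambda>m. complete_hom m k l * x ^ m) sums (\<Prod>j\<in>{k..l}. real j / (real j - x))"
  using assms(3)
proof (induction "Suc l - k" arbitrary: k)
  case 0
  have *: "complete_hom m k l * x ^ m = (if m = 0 then 1 else 0)" for m
    using 0 by (cases m) (auto simp: complete_hom_Suc_empty)
  have "(\<lambda>m. complete_hom m k l * x ^ m) sums 1"
    unfolding * using sums_single[of 0 "\<lambda>_. 1::real"] by simp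
  thus ?case using 0 by simp
next
  case (Suc d)
  hence kl: "k \<le> l" by simp
  have IH: "(\<lambda>m. complete_hom m (Suc k) l * x ^ m) sums (\<Prod>j\<in>{Suc k..l}. real j / (real j - x))"
    using Suc by simp
  have xk: "\<bar>x / real k\<bar> < 1" using assms(1,2) Suc.prems by (simp add: field_simps)
  have geo: "(\<lambda>m. (x / real k) ^ m) sums (1 / (1 - x / real k))"
    using geometric_sums[of "x / real k"] xk by simp
  have "(\<lambda>m. \<Sum>i\<le>m. (x / real k) ^ i * (complete_hom (m - i) (Suc k) l * x ^ (m - i))) sums
      (1 / (1 - x / real k) * (\<Prod>j\<in>{Suc k..l}. real j / (real j - x)))"
    by (rule nonneg_Cauchy_product_sums[OF geo IH]) (use assms(1) in \<open>auto simp: complete_hom_nonneg\<close>)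
  also have "(\<lambda>m. \<Sum>i\<le>m. (x / real k) ^ i * (complete_hom (m - i) (Suc k) l * x ^ (m - i))) = (\<lambda>m. complete_hom m k l * x ^ m)"
  proof
    fix m
    show "(\<Sum>i\<le>m. (x / real k) ^ i * (complete_hom (m - i) (Suc k) l * x ^ (m - i))) = complete_hom m k l * x ^ m"
      unfolding complete_hom_convolution[OF kl, of m] sum_distrib_right
    proof (rule sum.cong[OF refl])
      fix i assume "i \<in> {..m}"
      hence "x ^ m = x ^ i * x ^ (m - i)" by (simp flip: power_add)
      thus "(x / real k) ^ i * (complete_hom (m - i) (Suc k) l * x ^ (m - i)) =
        (1 / real k) ^ i * complete_hom (m - i) (Suc k) l * x ^ m"
        by (simp add: power_divide)
    qed
  qed
  also have "1 / (1 - x / real k) = real k / (real k - x)"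
    using Suc.prems by (simp add: field_simps)
  also have "real k / (real k - x) * (\<Prod>j\<in>{Suc k..l}. real j / (real j - x)) = (\<Prod>j\<in>{k..l}. real j / (real j - x))"
    using prod.atLeast_Suc_atMost[OF kl, of "\<lambda>j. real j / (real j - x)"] by simp
  finally show ?case .
qed

section \<open>Zeta-star values as sums over pairs\<close>

text \<open>
  The contribution to \<open>\<zeta>\<^sup>\<star>(a, {1}\<^sup>m, b)\<close> of all index sequences with first entry \<open>k\<close> and last entry \<open>l\<close>.
\<close>

definition star_term :: "nat \<Rightarrow> nat \<Rightarrow> nat \<Rightarrow> nat \<times> nat \<Rightarrow> real" where
  "star_term a m b = (\<lambda>(k, l). 1 / real k ^ a * complete_hom m k l / real l ^ b)"

lemma star_term_nonneg: "star_term a m b z \<ge> 0"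
  by (auto simp: star_term_def complete_hom_nonneg split: prod.split)

lemma zeta_value_has_sum:
  assumes "s \<ge> 2"
  shows "((\<lambda>k. 1 / real k ^ s) has_sum zeta_value s) {1..}"
proof -
  have "summable (\<lambda>k. inverse (real k ^ s))"
    using inverse_power_summable[OF assms, where ?'a=real] by simp
  hence "summable (\<lambda>k. 1 / real (Suc k) ^ s)"
    by (subst (asm) summable_Suc_iff[symmetric]) (simp add: inverse_eq_divide)
  hence "((\<lambda>k. 1 / real (Suc k) ^ s) has_sum zeta_value s) UNIV"
    by (intro sums_nonneg_imp_has_sum) (auto simp: zeta_value_def sums_iff)
  also have "?this \<longleftrightarrow> ?thesis"
    by (rule has_sum_reindex_bij_witness[of _ "\<lambda>k. k - 1" Suc]) auto
  finally show ?thesis .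
qed

text \<open>
  A sorted list of length \<open>m + 2\<close> consists of a first entry \<open>k\<close>, a last entry \<open>l\<close> and a sorted list
  of length \<open>m\<close> with entries in \<open>{k..l}\<close>; summing over the latter gives the symmetric polynomial.
\<close>

lemma zeta_star_decompose:
  assumes sum: "(star_term a m b has_sum s) {(k, l). 1 \<le> k \<and> k \<le> l}"
  shows "zeta_star ([a] @ replicate m 1 @ [b]) = s"
proof -
  let ?A = "{(k, l). 1 \<le> k \<and> k \<le> (l::nat)}"
  let ?S = "\<lambda>(k, l). {xs::nat list. length xs = m \<and> sorted xs \<and> set xs \<subseteq> {k..l}}"
  let ?f = "\<lambda>((k, l), xs). 1 / real k ^ a * (\<Prod>j\<leftarrow>xs. 1 / real j) / real l ^ b"
  let ?i = "\<lambda>((k, l), xs). k # xs @ [l]"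
  let ?j = "\<lambda>ks. ((hd ks, last ks), butlast (tl ks))"
  let ?\<alpha> = "[a] @ replicate m 1 @ [b]"
  have inner: "((\<lambda>xs. ?f (z, xs)) has_sum star_term a m b z) (?S z)" for z
  proof -
    obtain k l where z: "z = (k, l)" by (cases z)
    have "((\<lambda>xs. ?f (z, xs)) has_sum (\<Sum>xs\<in>?S z. ?f (z, xs))) (?S z)"
      by (rule has_sum_finite) (use finite_sorted_lists in \<open>auto simp: z\<close>)
    also have "(\<Sum>xs\<in>?S z. ?f (z, xs)) = star_term a m b z"
      by (simp add: z star_term_def complete_hom_def sum_distrib_left sum_divide_distrib)
    finally show ?thesis .
  qed
  have "?f summable_on Sigma ?A ?S"
    by (rule summable_on_SigmaI[OF inner])
       (use sum in \<open>auto simp: summable_on_def intro!: divide_nonneg_nonneg mult_nonneg_nonneg prod_list_nonneg\<close>)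
  hence *: "(?f has_sum s) (Sigma ?A ?S)"
    by (intro has_sum_SigmaI[OF inner sum])
  have "((\<lambda>ks. \<Prod>i<length ?\<alpha>. 1 / real (ks ! i) ^ (?\<alpha> ! i)) has_sum s)
      {ks. length ks = length ?\<alpha> \<and> sorted ks \<and> (\<forall>k\<in>set ks. 1 \<le> k)} \<longleftrightarrow> (?f has_sum s) (Sigma ?A ?S)"
  proof (rule has_sum_reindex_bij_witness[of _ ?i ?j])
    fix ks :: "nat list"
    assume ks: "ks \<in> {ks. length ks = length ?\<alpha> \<and> sorted ks \<and> (\<forall>k\<in>set ks. 1 \<le> k)}"
    hence "length ks = Suc (Suc m)" by simp
    then obtain k ys where "ks = k # ys" "length ys = Suc m"
      by (auto simp: length_Suc_conv)
    moreover from this(2) obtain xs l where "ys = xs @ [l]" "length xs = m"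
      unfolding length_Suc_conv_rev by blast
    ultimately have eq: "ks = k # xs @ [l]" and len: "length xs = m" by simp_all
    show "?i (?j ks) = ks"
      by (simp add: eq)
    show "?j ks \<in> Sigma ?A ?S"
      using ks by (auto simp: eq sorted_append)
    have "(\<Prod>i<length ?\<alpha>. 1 / real (ks ! i) ^ (?\<alpha> ! i)) =
        (\<Prod>i<Suc (Suc m). 1 / real (ks ! i) ^ (?\<alpha> ! i))" by simp
    also have "\<dots> = 1 / real k ^ a * ((\<Prod>i<m. 1 / real (ks ! Suc i) ^ (?\<alpha> ! Suc i)) * (1 / real l ^ b))"
      by (subst prod.lessThan_Suc_shift, subst prod.lessThan_Suc)
         (simp add: eq nth_append len)
    also have "(\<Prod>i<m. 1 / real (ks ! Suc i) ^ (?\<alpha> ! Suc i)) = (\<Prod>i<m. map (\<lambda>j. 1 / real j) xs ! i)"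
      by (rule prod.cong) (auto simp: eq nth_append len)
    also have "\<dots> = (\<Prod>j\<leftarrow>xs. 1 / real j)"
      by (simp add: prod.list_conv_set_nth len atLeast0LessThan)
    finally show "?f (?j ks) = (\<Prod>i<length ?\<alpha>. 1 / real (ks ! i) ^ (?\<alpha> ! i))"
      by (simp add: eq)
  next
    fix z assume "z \<in> Sigma ?A ?S"
    then obtain k l xs where z: "z = ((k, l), xs)" "1 \<le> k" "k \<le> l" "length xs = m" "sorted xs" "set xs \<subseteq> {k..l}"
      by auto
    show "?j (?i z) = z"
      by (simp add: z)
    show "?i z \<in> {ks. length ks = length ?\<alpha> \<and> sorted ks \<and> (\<forall>k\<in>set ks. 1 \<le> k)}"
      using z by (auto simp: sorted_append)
  qed (rule refl)
  from infsumI[OF iffD2[OF this *]] show ?thesis unfolding zeta_star_def .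
qed

text \<open>
  Subtracting the zeta value removes exactly the constant index sequences \<open>k = l\<close>, so the
  differences that occur in the theorem are sums over \<open>k < l\<close>.
\<close>

lemma zeta_star_minus_zeta:
  assumes sum: "(star_term a m b has_sum s) {(k, l). 1 \<le> k \<and> k < l}" and "a + m + b \<ge> 2"
  shows "zeta_star ([a] @ replicate m 1 @ [b]) - zeta_value (a + m + b) = s"
proof -
  have "((\<lambda>k. 1 / real k ^ (a + m + b)) has_sum zeta_value (a + m + b)) {1..}"
    by (rule zeta_value_has_sum) fact
  also have "?this \<longleftrightarrow> (star_term a m b has_sum zeta_value (a + m + b)) {(k, l). 1 \<le> k \<and> k = l}"
    by (rule has_sum_reindex_bij_witness[of _ fst "\<lambda>k. (k, k)"])
       (auto simp: star_term_def complete_hom_diag power_add)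
  finally have "(star_term a m b has_sum (zeta_value (a + m + b) + s))
      ({(k, l). 1 \<le> k \<and> k = l} \<union> {(k, l). 1 \<le> k \<and> k < l})"
    by (rule has_sum_Un_disjoint[OF _ sum]) auto
  also have "{(k, l). 1 \<le> k \<and> k = l} \<union> {(k, l). 1 \<le> k \<and> k < l} = {(k, l). 1 \<le> k \<and> k \<le> (l::nat)}"
    by auto
  finally show ?thesis using zeta_star_decompose by fastforce
qed


section \<open>The generating function of the zeta-star side\<close>

definition pairs_less :: "(nat \<times> nat) set" where
  "pairs_less = {(k, l). 1 \<le> k \<and> k < l}"

text \<open>
  The contribution of a pair \<open>(k, l)\<close> with \<open>k < l\<close> to the right-hand side of the theorem. The index \<open>i\<close>
  is \<open>\<alpha>\<^sub>1 - 1\<close>; the composition with \<open>\<alpha>\<^sub>2 = 1\<close> is left out since its weight \<open>2\<^sup>0 - 1\<close> vanishes, and this is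
  what makes every exponent of \<open>l\<close> at least 3.
\<close>

definition pair_coeff :: "nat \<Rightarrow> nat \<times> nat \<Rightarrow> real" where
  "pair_coeff p z = (\<Sum>m\<le>p. \<Sum>i\<le>p - m. star_term (Suc i) m (p - m - i + 3) z * (2 ^ (p - m - i + 1) - 1))"

text \<open>
  The generating function \<open>\<Sum>\<^sub>p pair_coeff p z x\<^sup>p\<close> in closed form.
\<close>

definition pair_gf :: "real \<Rightarrow> nat \<times> nat \<Rightarrow> real" where
  "pair_gf x = (\<lambda>(k, l). (\<Prod>j\<in>{k..l}. real j / (real j - x)) /
     ((real k - x) * (real l * (real l - x) * (real l - 2 * x))))"

lemma two_power_minus_1_nonneg: "(2::real) ^ n - 1 \<ge> 0"
  by simp

lemma pair_coeff_nonneg: "pair_coeff p z \<ge> 0"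
  unfolding pair_coeff_def by (intro sum_nonneg mult_nonneg_nonneg star_term_nonneg two_power_minus_1_nonneg)

text \<open>
  A product of three power series: the symmetric polynomials, the geometric series of
  \<open>1 / (k - x)\<close> coming from \<open>\<alpha>\<^sub>1\<close>, and the series coming from \<open>\<alpha>\<^sub>2\<close>, where the weights
  \<open>2\<^sup>b - 1\<close> with \<open>b = \<alpha>\<^sub>2 - 1\<close> produce the difference of two geometric series with ratios \<open>2x/l\<close> and \<open>x/l\<close>.
\<close>

lemma pair_coeff_sums:
  fixes x :: real
  assumes x: "0 \<le> x" "x \<le> 1/4" and kl: "1 \<le> k" "1 \<le> l"
  shows "(\<lambda>p. pair_coeff p (k, l) * x ^ p) sums pair_gf x (k, l)"
proof -
  let ?a = "\<lambda>i. 1 / real k ^ Suc i * x ^ i"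
  let ?b = "\<lambda>i. (2 ^ Suc i - 1) / real l ^ (i + 3) * x ^ i"
  let ?c = "\<lambda>m. complete_hom m k l * x ^ m"
  have a_nonneg: "?a i \<ge> 0" and b_nonneg: "?b i \<ge> 0" and c_nonneg: "?c i \<ge> 0" for i
    using x by (intro mult_nonneg_nonneg divide_nonneg_nonneg two_power_minus_1_nonneg complete_hom_nonneg; simp)+
  have a: "?a sums (1 / (real k - x))"
  proof -
    have "\<bar>x / real k\<bar> < 1" using x kl by (simp add: field_simps)
    from sums_mult[OF geometric_sums[of "x / real k"], of "1 / real k"] this
    have "(\<lambda>i. 1 / real k * (x / real k) ^ i) sums (1 / real k * (1 / (1 - x / real k)))" by simp
    also have "1 / real k * (1 / (1 - x / real k)) = 1 / (real k - x)"
      using kl by (simp add: field_simps)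
    finally show ?thesis by (simp add: power_divide)
  qed
  have b: "?b sums (1 / (real l * (real l - x) * (real l - 2 * x)))"
  proof -
    have 1: "\<bar>x / real l\<bar> < 1" "\<bar>2 * x / real l\<bar> < 1" using x kl by (auto simp: field_simps)
    have "(\<lambda>i. 2 / real l ^ 3 * (2 * x / real l) ^ i - 1 / real l ^ 3 * (x / real l) ^ i) sums
        (2 / real l ^ 3 * (1 / (1 - 2 * x / real l)) - 1 / real l ^ 3 * (1 / (1 - x / real l)))"
      by (intro sums_diff sums_mult geometric_sums) (use 1 in auto)
    also have "2 / real l ^ 3 * (1 / (1 - 2 * x / real l)) - 1 / real l ^ 3 * (1 / (1 - x / real l))
        = 1 / (real l * (real l - x) * (real l - 2 * x))"
    proof -
      have "real l \<noteq> 0" "real l - x \<noteq> 0" "real l - 2 * x \<noteq> 0" using x kl by auto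
      thus ?thesis by (simp add: divide_simps) (simp add: algebra_simps power3_eq_cube)
    qed
    also have "(\<lambda>i. 2 / real l ^ 3 * (2 * x / real l) ^ i - 1 / real l ^ 3 * (x / real l) ^ i) = ?b"
      using kl by (auto simp: fun_eq_iff power_divide power_mult_distrib power_add field_simps)
    finally show ?thesis .
  qed
  have c: "?c sums (\<Prod>j\<in>{k..l}. real j / (real j - x))"
    by (rule complete_hom_sums) (use x kl in auto)
  have ab: "(\<lambda>n. \<Sum>i\<le>n. ?a i * ?b (n - i)) sums (1 / (real k - x) * (1 / (real l * (real l - x) * (real l - 2 * x))))"
    by (rule nonneg_Cauchy_product_sums[OF a b a_nonneg b_nonneg])
  have "(\<lambda>p. \<Sum>m\<le>p. ?c m * (\<Sum>i\<le>p - m. ?a i * ?b (p - m - i))) sums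
     ((\<Prod>j\<in>{k..l}. real j / (real j - x)) * (1 / (real k - x) * (1 / (real l * (real l - x) * (real l - 2 * x)))))"
    by (intro nonneg_Cauchy_product_sums[OF c ab] c_nonneg sum_nonneg mult_nonneg_nonneg a_nonneg b_nonneg)
  also have "(\<Prod>j\<in>{k..l}. real j / (real j - x)) * (1 / (real k - x) * (1 / (real l * (real l - x) * (real l - 2 * x)))) = pair_gf x (k, l)"
    by (simp add: pair_gf_def)
  also have "(\<lambda>p. \<Sum>m\<le>p. ?c m * (\<Sum>i\<le>p - m. ?a i * ?b (p - m - i))) = (\<lambda>p. pair_coeff p (k, l) * x ^ p)"
  proof
    fix p
    have "?c m * (?a i * ?b (p - m - i)) =
      star_term (Suc i) m (p - m - i + 3) (k, l) * (2 ^ (p - m - i + 1) - 1) * x ^ p"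
      if "m \<le> p" "i \<le> p - m" for m i
    proof -
      have "x ^ p = x ^ m * x ^ i * x ^ (p - m - i)" using that by (simp flip: power_add)
      thus ?thesis by (simp add: star_term_def)
    qed
    thus "(\<Sum>m\<le>p. ?c m * (\<Sum>i\<le>p - m. ?a i * ?b (p - m - i))) = pair_coeff p (k, l) * x ^ p"
      unfolding pair_coeff_def sum_distrib_left sum_distrib_right
      by (intro sum.cong refl) auto
  qed
  finally show ?thesis .
qed

text \<open>
  For small \<open>x\<close> each factor is at most \<open>(j + 1) / j\<close>, and these telescope. The resulting linear
  growth in \<open>l\<close> is weak enough for all sums over pairs below to converge.
\<close>

lemma prod_ratio_le:
  fixes x :: real
  assumes x: "0 \<le> x" "x \<le> 1/4" and kl: "1 \<le> k" "k \<le> l"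
  shows "(\<Prod>j\<in>{k..l}. real j / (real j - x)) \<le> real (Suc l) / real k"
proof -
  have "(\<Prod>j\<in>{k..l}. real j / (real j - x)) \<le> (\<Prod>j\<in>{k..l}. real (Suc j) / real j)"
  proof (rule prod_mono)
    fix j assume "j \<in> {k..l}"
    hence j: "real j \<ge> 1" using kl by simp
    have "real j * x \<le> real j * (1/4)" using x by (intro mult_left_mono) auto
    hence "real j * x + x \<le> real j" using x j by linarith
    hence "real j / (real j - x) \<le> real (Suc j) / real j"
      using x j by (simp add: field_simps)
    thus "0 \<le> real j / (real j - x) \<and> real j / (real j - x) \<le> real (Suc j) / real j"
      using x j by simp
  qed
  also have "\<dots> = real (Suc l) / real k"
    using kl(2)
  proof (induction l rule: dec_induct)
    case (step n)
    have "{k..Suc n} = insert (Suc n) {k..n}" using step by auto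
    hence "(\<Prod>j\<in>{k..Suc n}. real (Suc j) / real j) =
        real (Suc (Suc n)) / real (Suc n) * (\<Prod>j\<in>{k..n}. real (Suc j) / real j)" by simp
    also have "\<dots> = real (Suc (Suc n)) / real k"
      unfolding step.IH by (simp del: of_nat_Suc)
    finally show ?case .
  qed (use kl in auto)
  finally show ?thesis .
qed

lemma summable_inverse_squares:
  "(\<lambda>(k, l). 1 / (real k ^ 2 * real l ^ 2)) summable_on pairs_less"
proof (rule summable_on_subset_banach)
  show "(\<lambda>(k, l). 1 / (real k ^ 2 * real l ^ 2)) summable_on ({1..} \<times> {1..})"
  proof (rule summable_on_SigmaI)
    fix k :: nat
    show "((\<lambda>l. (\<lambda>(k, l). 1 / (real k ^ 2 * real l ^ 2)) (k, l)) has_sum (1 / real k ^ 2 * zeta_value 2)) {1..}"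
      using has_sum_cmult_right[OF zeta_value_has_sum[of 2], of "1 / real k ^ 2"] by simp
  next
    show "(\<lambda>k. 1 / real k ^ 2 * zeta_value 2) summable_on {1..}"
      using zeta_value_has_sum[of 2] by (intro summable_on_cmult_left) (auto simp: summable_on_def)
  qed auto
  show "pairs_less \<subseteq> {1..} \<times> {1..}" by (auto simp: pairs_less_def)
qed

text \<open>
  The bound \<open>x \<le> 1/4\<close> keeps \<open>l - 2x\<close> at least \<open>l/2\<close>, so that the three factors in \<open>l\<close> beat the
  linear growth of the product by two powers.
\<close>

lemma pair_gf_bounds:
  fixes x :: real
  assumes x: "0 \<le> x" "x \<le> 1/4" and kl: "1 \<le> k" "k < l"
  shows "0 \<le> pair_gf x (k, l)" "pair_gf x (k, l) \<le> 8 * (1 / (real k ^ 2 * real l ^ 2))"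
proof -
  have nn: "(\<Prod>j\<in>{k..l}. real j / (real j - x)) \<ge> 0"
    using x kl by (intro prod_nonneg divide_nonneg_nonneg) auto
  have k: "real k - x \<ge> 3/4 * real k" and l: "real l - x \<ge> 3/4 * real l" and l': "real l - 2 * x \<ge> 1/2 * real l"
    using x kl by auto
  have l0: "real l \<ge> 1" "real k \<ge> 1" using kl by auto
  show "0 \<le> pair_gf x (k, l)"
    using nn x kl unfolding pair_gf_def by (auto intro!: divide_nonneg_nonneg mult_nonneg_nonneg)
  have "pair_gf x (k, l) \<le> (real (Suc l) / real k) / ((3/4 * real k) * (real l * (3/4 * real l) * (1/2 * real l)))"
    unfolding pair_gf_def prod.case
    by (intro frac_le mult_mono prod_ratio_le mult_pos_pos) (use x kl k l l' in auto)
  also have "\<dots> \<le> (2 * real l / real k) / ((3/4 * real k) * (real l * (3/4 * real l) * (1/2 * real l)))"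
    by (intro divide_right_mono) (use l0 in auto)
  also have "\<dots> = 64/9 * (1 / (real k ^ 2 * real l ^ 2))"
    using l0 by (simp add: field_simps power2_eq_square)
  also have "\<dots> \<le> 8 * (1 / (real k ^ 2 * real l ^ 2))"
    by (intro mult_right_mono) auto
  finally show "pair_gf x (k, l) \<le> 8 * (1 / (real k ^ 2 * real l ^ 2))" .
qed

lemma pair_gf_summable:
  fixes x :: real
  assumes x: "0 \<le> x" "x \<le> 1/4"
  shows "pair_gf x summable_on pairs_less"
proof (rule summable_on_comparison_test)
  show "(\<lambda>z. 8 * (\<lambda>(k, l). 1 / (real k ^ 2 * real l ^ 2)) z) summable_on pairs_less"
    by (intro summable_on_cmult_right summable_inverse_squares)
qed (use pair_gf_bounds[OF x] in \<open>auto simp: pairs_less_def\<close>)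

text \<open>
  A single symmetric polynomial is bounded through its generating function at \<open>x = 1/4\<close>, at the cost
  of a factor \<open>4\<^sup>m\<close>.
\<close>

lemma star_term_summable:
  assumes "1 \<le> a" "3 \<le> b"
  shows "star_term a m b summable_on pairs_less"
proof (rule summable_on_comparison_test)
  show "(\<lambda>z. (2 * 4 ^ m) * (\<lambda>(k, l). 1 / (real k ^ 2 * real l ^ 2)) z) summable_on pairs_less"
    by (intro summable_on_cmult_right summable_inverse_squares)
next
  fix z assume "z \<in> pairs_less"
  then obtain k l where z: "z = (k, l)" and kl: "1 \<le> k" "k < l" by (auto simp: pairs_less_def)
  have sums: "(\<lambda>m. complete_hom m k l * (1/4) ^ m) sums (\<Prod>j\<in>{k..l}. real j / (real j - 1/4))"
    by (rule complete_hom_sums) (use kl in auto)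
  have "complete_hom m k l * (1/4) ^ m = (\<Sum>i\<in>{m}. complete_hom i k l * (1/4) ^ i)" by simp
  also have "\<dots> \<le> (\<Sum>i. complete_hom i k l * (1/4) ^ i)"
    using sums by (intro sum_le_suminf) (auto simp: sums_iff complete_hom_nonneg)
  also have "\<dots> = (\<Prod>j\<in>{k..l}. real j / (real j - 1/4))" using sums by (simp add: sums_iff)
  also have "\<dots> \<le> real (Suc l) / real k" by (rule prod_ratio_le) (use kl in auto)
  also have "\<dots> \<le> 2 * real l / real k" using kl by (intro divide_right_mono) auto
  finally have complete_hom: "complete_hom m k l \<le> 4 ^ m * (2 * real l / real k)"
    by (simp add: field_simps)
  have "star_term a m b z = complete_hom m k l * (1 / (real k ^ a * real l ^ b))"
    by (simp add: z star_term_def)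
  also have "\<dots> \<le> (4 ^ m * (2 * real l / real k)) * (1 / (real k ^ 1 * real l ^ 3))"
    using kl assms by (intro mult_mono complete_hom frac_le power_increasing) auto
  also have "\<dots> = (2 * 4 ^ m) * (1 / (real k ^ 2 * real l ^ 2))"
    using kl by (simp add: field_simps power2_eq_square power3_eq_cube)
  finally show "star_term a m b z \<le> (2 * 4 ^ m) * (\<lambda>(k, l). 1 / (real k ^ 2 * real l ^ 2)) z"
    by (simp add: z)
qed (rule star_term_nonneg)

definition star_side :: "nat \<Rightarrow> real" where
  "star_side p = (\<Sum>(m, n) | m + n = p.
      \<Sum>(\<alpha>\<^sub>1, \<alpha>\<^sub>2) | 1 \<le> \<alpha>\<^sub>1 \<and> 1 \<le> \<alpha>\<^sub>2 \<and> \<alpha>\<^sub>1 + \<alpha>\<^sub>2 = n + 3.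
        (zeta_star ([\<alpha>\<^sub>1] @ replicate m 1 @ [\<alpha>\<^sub>2 + 1]) - zeta_value (p + 4)) * (2 ^ (\<alpha>\<^sub>2 - 1) - 1))"

lemma has_sum_sum:
  fixes f :: "'a \<Rightarrow> 'b \<Rightarrow> real"
  assumes "finite I" "\<And>i. i \<in> I \<Longrightarrow> (f i has_sum s i) A"
  shows "((\<lambda>z. \<Sum>i\<in>I. f i z) has_sum (\<Sum>i\<in>I. s i)) A"
  using assms by (induction I rule: finite_induct) (auto intro!: has_sum_add)

lemma sum_pairs_atMost:
  fixes F :: "nat \<Rightarrow> nat \<Rightarrow> real"
  shows "(\<Sum>(m, n) | m + n = p. F m n) = (\<Sum>m\<le>p. F m (p - m))"
  by (rule sum.reindex_bij_witness[of _ "\<lambda>m. (m, p - m)" fst]) auto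

text \<open>
  The composition with \<open>b = 1\<close> drops out; in the application its summand carries the weight
  \<open>2\<^sup>0 - 1 = 0\<close>.
\<close>

lemma sum_compositions:
  fixes F :: "nat \<Rightarrow> nat \<Rightarrow> real"
  assumes "F (n + 2) 1 = 0"
  shows "(\<Sum>(a, b) | 1 \<le> a \<and> 1 \<le> b \<and> a + b = n + 3. F a b) = (\<Sum>i\<le>n. F (Suc i) (n - i + 2))"
proof -
  have eq: "{(a, b). 1 \<le> a \<and> 1 \<le> b \<and> a + b = n + 3} =
     insert (n + 2, 1) ((\<lambda>i. (Suc i, n - i + 2)) ` {..n})"
  proof (intro equalityI subsetI)
    fix z assume "z \<in> {(a, b). 1 \<le> a \<and> 1 \<le> b \<and> a + b = n + 3}"
    then obtain a b where z: "z = (a, b)" "1 \<le> a" "1 \<le> b" "a + b = n + 3" by auto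
    show "z \<in> insert (n + 2, 1) ((\<lambda>i. (Suc i, n - i + 2)) ` {..n})"
    proof (cases "b = 1")
      case False
      hence "z = (\<lambda>i. (Suc i, n - i + 2)) (a - 1)" "a - 1 \<in> {..n}" using z by auto
      thus ?thesis by blast
    qed (use z in auto)
  qed auto
  have "(\<Sum>(a, b) | 1 \<le> a \<and> 1 \<le> b \<and> a + b = n + 3. F a b) =
     (\<Sum>(a, b)\<in>(\<lambda>i. (Suc i, n - i + 2)) ` {..n}. F a b)"
    unfolding eq by (subst sum.insert) (use assms in auto)
  also have "\<dots> = (\<Sum>i\<le>n. F (Suc i) (n - i + 2))"
    by (subst sum.reindex) (auto simp: inj_on_def)
  finally show ?thesis .
qed

lemma pair_coeff_has_sum: "(pair_coeff p has_sum star_side p) pairs_less"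
proof -
  let ?t = "\<lambda>m i z. star_term (Suc i) m (p - m - i + 3) z * (2 ^ (p - m - i + 1) - 1)"
  let ?s = "\<lambda>m i. (zeta_star ([Suc i] @ replicate m 1 @ [p - m - i + 3]) - zeta_value (p + 4)) * (2 ^ (p - m - i + 1) - 1)"
  have single: "(?t m i has_sum ?s m i) pairs_less" if "m \<le> p" "i \<le> p - m" for m i
  proof -
    obtain s where s: "(star_term (Suc i) m (p - m - i + 3) has_sum s) pairs_less"
      using star_term_summable[of "Suc i" "p - m - i + 3" m] by (auto simp: summable_on_def)
    have "zeta_star ([Suc i] @ replicate m 1 @ [p - m - i + 3]) - zeta_value (Suc i + m + (p - m - i + 3)) = s"
      by (rule zeta_star_minus_zeta) (use s in \<open>auto simp: pairs_less_def\<close>)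
    moreover have "Suc i + m + (p - m - i + 3) = p + 4" using that by simp
    ultimately have "zeta_star ([Suc i] @ replicate m 1 @ [p - m - i + 3]) - zeta_value (p + 4) = s"
      by (simp only:)
    thus ?thesis using has_sum_cmult_left[OF s] by simp
  qed
  have "((\<lambda>z. \<Sum>m\<le>p. \<Sum>i\<le>p - m. ?t m i z) has_sum (\<Sum>m\<le>p. \<Sum>i\<le>p - m. ?s m i)) pairs_less"
    by (intro has_sum_sum single) auto
  also have "(\<Sum>m\<le>p. \<Sum>i\<le>p - m. ?s m i) = star_side p"
    unfolding star_side_def
    by (subst sum_pairs_atMost, subst sum_compositions) (auto simp: numeral_3_eq_3)
  finally show ?thesis unfolding pair_coeff_def[abs_def] .
qed

text \<open>
  All terms are nonnegative, so summing over \<open>p\<close> and over pairs may be interchanged; the sum over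
  \<open>p\<close> first is known in closed form and dominated by a convergent double series.
\<close>

lemma star_side_sums:
  fixes x :: real
  assumes x: "0 \<le> x" "x \<le> 1/4"
  shows "(\<lambda>p. star_side p * x ^ p) sums infsum (pair_gf x) pairs_less"
proof -
  let ?f = "\<lambda>(z, p). pair_coeff p z * x ^ p"
  have inner: "((\<lambda>p. ?f (z, p)) has_sum pair_gf x z) UNIV" if "z \<in> pairs_less" for z
  proof -
    obtain k l where z: "z = (k, l)" by (cases z)
    hence "1 \<le> k" "1 \<le> l" using that by (auto simp: pairs_less_def)
    with z show ?thesis using pair_coeff_sums[OF x, of k l] x
      by (auto intro!: sums_nonneg_imp_has_sum mult_nonneg_nonneg pair_coeff_nonneg)
  qed
  have "?f summable_on (pairs_less \<times> UNIV)"
    by (rule summable_on_SigmaI[OF inner pair_gf_summable[OF x]])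
       (use x in \<open>auto intro!: mult_nonneg_nonneg pair_coeff_nonneg\<close>)
  hence "(?f has_sum infsum (pair_gf x) pairs_less) (pairs_less \<times> UNIV)"
    by (intro has_sum_SigmaI[OF inner]) (auto intro!: has_sum_infsum pair_gf_summable x)
  hence "((\<lambda>(p, z). pair_coeff p z * x ^ p) has_sum infsum (pair_gf x) pairs_less) (UNIV \<times> pairs_less)"
    by (subst (asm) has_sum_swap) simp
  hence "((\<lambda>p. star_side p * x ^ p) has_sum infsum (pair_gf x) pairs_less) UNIV"
    by (rule has_sum_SigmaD) (auto intro!: has_sum_cmult_left pair_coeff_has_sum)
  thus ?thesis by (rule has_sum_imp_sums)
qed

section \<open>One-dimensional integrals\<close>

lemma nn_integral_Ioo_has_integral:
  fixes f :: "real \<Rightarrow> real"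
  assumes "(f has_integral I) {a..b}" "\<And>s. a < s \<Longrightarrow> s < b \<Longrightarrow> 0 \<le> f s"
  shows "(\<integral>\<^sup>+s. ennreal (f s) * indicator {a<..<b} s \<partial>lborel) = ennreal I"
  using assms by (intro nn_integral_has_integral_lebesgue') (auto simp: has_integral_Icc_iff_Ioo)

lemma nn_integral_powr_from_0:
  assumes "a > -1" "u \<ge> 0"
  shows "(\<integral>\<^sup>+s. ennreal (s powr a) * indicator {0<..<u} s \<partial>lborel) = ennreal (u powr (a + 1) / (a + 1))"
  using has_integral_powr_from_0[OF assms] by (rule nn_integral_Ioo_has_integral) simp

lemma nn_integral_powr_between:
  assumes "0 < x" "0 < a" "a \<le> b"
  shows "(\<integral>\<^sup>+t. ennreal (t powr (x - 1)) * indicator {a<..<b} t \<partial>lborel) = ennreal ((b powr x - a powr x) / x)"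
proof (rule nn_integral_Ioo_has_integral)
  have "((\<lambda>t. t powr (x - 1)) has_integral (b powr x / x - a powr x / x)) {a..b}"
    using assms
    by (intro fundamental_theorem_of_calculus)
       (auto intro!: derivative_eq_intros simp: has_real_derivative_iff_has_vector_derivative[symmetric])
  thus "((\<lambda>t. t powr (x - 1)) has_integral ((b powr x - a powr x) / x)) {a..b}"
    by (simp add: diff_divide_distrib)
qed simp

text \<open>
  The integral over \<open>u\<^sub>1\<close> of one power, once \<open>t\<^sub>2\<close> has been integrated from \<open>u\<^sub>1\<close> to \<open>u = u\<^sub>2\<close>: the
  two powers contribute \<open>1/a\<close> and \<open>1/(a + x)\<close>, whose difference is \<open>x / (a (a + x))\<close>.
\<close>

lemma nn_integral_powr_diff:
  assumes "0 < x" "0 < a" "0 \<le> u"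
  shows "(\<integral>\<^sup>+s. ennreal (s powr (a - 1) * ((u powr x - s powr x) / x)) * indicator {0<..<u} s \<partial>lborel)
     = ennreal (u powr (a + x) / (a * (a + x)))"
proof (rule nn_integral_Ioo_has_integral)
  have "((\<lambda>s. (u powr x * s powr (a - 1) - s powr (a + x - 1)) / x) has_integral
      ((u powr x * (u powr (a - 1 + 1) / (a - 1 + 1)) - u powr (a + x - 1 + 1) / (a + x - 1 + 1)) / x)) {0..u}"
    using assms by (intro has_integral_divide has_integral_diff has_integral_mult_right has_integral_powr_from_0) auto
  also have "(u powr x * (u powr (a - 1 + 1) / (a - 1 + 1)) - u powr (a + x - 1 + 1) / (a + x - 1 + 1)) / x
      = u powr (a + x) / (a * (a + x))"
    using assms by (simp add: powr_add divide_simps) (simp add: algebra_simps)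
  also have "(\<lambda>s. (u powr x * s powr (a - 1) - s powr (a + x - 1)) / x) = (\<lambda>s. s powr (a - 1) * ((u powr x - s powr x) / x))"
    by (auto simp: fun_eq_iff right_diff_distrib powr_add[symmetric] algebra_simps)
  finally show "((\<lambda>s. s powr (a - 1) * ((u powr x - s powr x) / x)) has_integral u powr (a + x) / (a * (a + x))) {0..u}" .
qed (use assms in \<open>auto intro!: mult_nonneg_nonneg divide_nonneg_nonneg powr_mono2\<close>)

lemma nn_integral_beta:
  assumes "x < 1" "1 \<le> N"
  shows "(\<integral>\<^sup>+u. ennreal (u powr (real N - 1) * (1 - u) powr (- x)) * indicator {0<..<1} u \<partial>lborel)
     = ennreal (fact (N - 1) / pochhammer (1 - x) N)"
proof (rule nn_integral_Ioo_has_integral)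
  have "((\<lambda>u. u powr (real N - 1) * (1 - u) powr ((1 - x) - 1)) has_integral Beta (real N) (1 - x)) {0..1}"
    using assms by (intro has_integral_Beta_real) auto
  moreover have "Beta (real N) (1 - x) = fact (N - 1) / pochhammer (1 - x) N"
  proof -
    have "1 - x \<notin> \<int>\<^sub>\<le>\<^sub>0" using assms(1) by (auto elim!: nonpos_Ints_cases)
    hence "pochhammer (1 - x) N = Gamma (1 - x + real N) / Gamma (1 - x)" "Gamma (1 - x) \<noteq> 0"
      by (auto simp: pochhammer_Gamma Gamma_eq_zero_iff)
    moreover have "Gamma (real N) = fact (N - 1)"
      using Gamma_fact[of "N - 1", where ?'a = real] assms(2) by simp
    ultimately show ?thesis by (simp add: Beta_def add.commute)
  qed
  ultimately show "((\<lambda>u. u powr (real N - 1) * (1 - u) powr (- x)) has_integral (fact (N - 1) / pochhammer (1 - x) N)) {0..1}"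
    by simp
qed simp

text \<open>
  The binomial series, written with Pochhammer symbols to make the coefficients visibly nonnegative.
\<close>

lemma binomial_series_sums:
  fixes x t :: real
  assumes "0 < t" "t < 1"
  shows "(\<lambda>k. pochhammer (1 - x) k / fact k * t ^ k) sums ((1 - t) powr (x - 1))"
proof -
  have "(\<lambda>k. ((x - 1) gchoose k) * (- t) ^ k) sums (1 + - t) powr (x - 1)"
    using assms by (intro gen_binomial_real) auto
  moreover have "((x - 1) gchoose k) * (- t) ^ k = pochhammer (1 - x) k / fact k * t ^ k" for k
  proof -
    have "(- 1) ^ k * (- t) ^ k = t ^ k" by (simp flip: power_mult_distrib)
    thus ?thesis by (simp add: gbinomial_pochhammer field_simps)
  qed
  ultimately show ?thesis by simp
qed

text \<open>
  The binomial series integrated term by term. The series is kept as it stands, so that the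
  remaining integrals are integrals of powers as well.
\<close>

lemma nn_integral_t1:
  fixes x u :: real
  assumes x: "0 < x" "x < 1" and u: "0 < u" "u < 1"
  shows "(\<integral>\<^sup>+t. ennreal ((1 - t) powr (x - 1) * t powr (- x)) * indicator {0<..<u} t \<partial>lborel)
    = (\<Sum>k. ennreal (pochhammer (1 - x) k / fact k / (real k + 1 - x) * u powr (real k + 1 - x)))"
proof -
  let ?c = "\<lambda>k. pochhammer (1 - x) k / fact k"
  have c: "?c k \<ge> 0" for k using x by (simp add: pochhammer_nonneg)
  have "ennreal ((1 - t) powr (x - 1) * t powr (- x)) * indicator {0<..<u} t
     = (\<Sum>k. ennreal (?c k) * (ennreal (t powr (real k - x)) * indicator {0<..<u} t))" for t
  proof (cases "t \<in> {0<..<u}")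
    case True
    hence t: "0 < t" "t < 1" using u by auto
    have "(\<lambda>k. ?c k * t ^ k * t powr (- x)) sums ((1 - t) powr (x - 1) * t powr (- x))"
      by (intro sums_mult2 binomial_series_sums t)
    also have "(\<lambda>k. ?c k * t ^ k * t powr (- x)) = (\<lambda>k. ?c k * t powr (real k - x))"
      using t by (simp add: fun_eq_iff powr_diff powr_minus powr_realpow field_simps)
    finally have "(\<Sum>k. ennreal (?c k * t powr (real k - x))) = ennreal ((1 - t) powr (x - 1) * t powr (- x))"
      using c by (intro suminf_ennreal_eq mult_nonneg_nonneg powr_ge_zero)
    hence "(\<Sum>k. ennreal (?c k) * ennreal (t powr (real k - x))) = ennreal ((1 - t) powr (x - 1) * t powr (- x))"
      by (simp only: ennreal_mult[OF c powr_ge_zero])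
    thus ?thesis using True by (simp only: indicator_simps mult_1_right)
  qed auto
  hence "(\<integral>\<^sup>+t. ennreal ((1 - t) powr (x - 1) * t powr (- x)) * indicator {0<..<u} t \<partial>lborel)
    = (\<integral>\<^sup>+t. (\<Sum>k. ennreal (?c k) * (ennreal (t powr (real k - x)) * indicator {0<..<u} t)) \<partial>lborel)"
    by simp
  also have "\<dots> = (\<Sum>k. ennreal (?c k) * (\<integral>\<^sup>+t. ennreal (t powr (real k - x)) * indicator {0<..<u} t \<partial>lborel))"
    by (subst nn_integral_suminf) (auto simp: nn_integral_cmult)
  also have "\<dots> = (\<Sum>k. ennreal (?c k / (real k + 1 - x) * u powr (real k + 1 - x)))"
  proof (rule suminf_cong)
    fix k
    have "(\<integral>\<^sup>+t. ennreal (t powr (real k - x)) * indicator {0<..<u} t \<partial>lborel) =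
       ennreal (u powr (real k + 1 - x) / (real k + 1 - x))"
      using nn_integral_powr_from_0[of "real k - x" u] x u by (simp add: algebra_simps)
    thus "ennreal (?c k) * (\<integral>\<^sup>+t. ennreal (t powr (real k - x)) * indicator {0<..<u} t \<partial>lborel) =
       ennreal (?c k / (real k + 1 - x) * u powr (real k + 1 - x))"
      using c x by (simp add: ennreal_mult[symmetric])
  qed
  finally show ?thesis .
qed

section \<open>Integrating out the four variables\<close>

lemma nn_integral_double_series:
  fixes f :: "nat \<Rightarrow> nat \<Rightarrow> 'a \<Rightarrow> ennreal"
  assumes [measurable]: "\<And>k i. f k i \<in> borel_measurable M"
  shows "(\<integral>\<^sup>+z. (\<Sum>k. \<Sum>i. c k i * f k i z) \<partial>M) = (\<Sum>k. \<Sum>i. c k i * (\<integral>\<^sup>+z. f k i z \<partial>M))"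
proof -
  have "(\<integral>\<^sup>+z. (\<Sum>k. \<Sum>i. c k i * f k i z) \<partial>M) = (\<Sum>k. \<integral>\<^sup>+z. (\<Sum>i. c k i * f k i z) \<partial>M)"
    by (rule nn_integral_suminf) measurable
  also have "\<dots> = (\<Sum>k. \<Sum>i. \<integral>\<^sup>+z. c k i * f k i z \<partial>M)"
    by (intro suminf_cong nn_integral_suminf) measurable
  also have "\<dots> = (\<Sum>k. \<Sum>i. c k i * (\<integral>\<^sup>+z. f k i z \<partial>M))"
    by (intro suminf_cong nn_integral_cmult) measurable
  finally show ?thesis .
qed

text \<open>
  The geometric series of \<open>1 / (1 - s)\<close> introduces the second summation index \<open>i\<close>; the exponents then
  only involve \<open>k + i + 2\<close>, which is going to be the larger index \<open>l\<close> of a pair, with \<open>k + 1\<close> the smaller.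
\<close>

lemma nn_integral_u1:
  fixes x u :: real
  assumes x: "0 < x" "x \<le> 1/4" and u: "0 < u" "u < 1"
  shows "(\<integral>\<^sup>+s. ennreal (s powr (- x) / (1 - s)) * ennreal ((u powr x - s powr x) / x) *
       (\<Sum>k. ennreal (pochhammer (1 - x) k / fact k / (real k + 1 - x) * s powr (real k + 1 - x))) *
       indicator {0<..<u} s \<partial>lborel)
    = (\<Sum>k. \<Sum>i. ennreal (pochhammer (1 - x) k / fact k / (real k + 1 - x) *
        (u powr (real (k + i + 2) - x) / ((real (k + i + 2) - 2 * x) * (real (k + i + 2) - x)))))"
proof -
  define d where "d = (\<lambda>k. pochhammer (1 - x) k / fact k / (real k + 1 - x))"
  have d: "d k \<ge> 0" for k using x by (simp add: pochhammer_nonneg d_def)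
  have pw: "ennreal (s powr (- x) / (1 - s)) * ennreal ((u powr x - s powr x) / x) *
       (\<Sum>k. ennreal (d k * s powr (real k + 1 - x))) * indicator {0<..<u} s =
     (\<Sum>k. \<Sum>i. ennreal (d k) *
        (ennreal (s powr ((real (k + i + 2) - 2 * x) - 1) * ((u powr x - s powr x) / x)) * indicator {0<..<u} s))" for s
  proof (cases "s \<in> {0<..<u}")
    case True
    hence s: "0 < s" "s < u" "s < 1" using u by auto
    have le: "(u powr x - s powr x) / x \<ge> 0" using s x by (auto intro!: divide_nonneg_nonneg powr_mono2)
    have geo: "(\<lambda>i. s ^ i * s powr (- x)) sums (1 / (1 - s) * s powr (- x))"
      using s by (intro sums_mult2 geometric_sums) auto
    have C: "ennreal (s powr (- x) / (1 - s)) = (\<Sum>i. ennreal (s ^ i * s powr (- x)))"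
    proof -
      have "(\<Sum>i. ennreal (s ^ i * s powr (- x))) = ennreal (1 / (1 - s) * s powr (- x))"
        by (rule suminf_ennreal_eq[OF _ geo]) (use s in simp)
      also have "1 / (1 - s) * s powr (- x) = s powr (- x) / (1 - s)" by simp
      finally show ?thesis ..
    qed
    have "(\<Sum>i. ennreal (d k) * ennreal (s powr ((real (k + i + 2) - 2 * x) - 1) * ((u powr x - s powr x) / x)))
       = ennreal (s powr (- x) / (1 - s)) * ennreal ((u powr x - s powr x) / x) * ennreal (d k * s powr (real k + 1 - x))" for k
    proof -
      have "ennreal (d k) * ennreal (s powr ((real (k + i + 2) - 2 * x) - 1) * ((u powr x - s powr x) / x)) =
         ennreal (s ^ i * s powr (- x)) * (ennreal ((u powr x - s powr x) / x) * ennreal (d k * s powr (real k + 1 - x)))" for i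
      proof -
        have "s powr ((real (k + i + 2) - 2 * x) - 1) = s powr (real i + (- x) + (real k + 1 - x))"
          by (simp add: algebra_simps)
        also have "\<dots> = s ^ i * s powr (- x) * s powr (real k + 1 - x)"
          using s by (simp only: powr_add) (simp add: powr_realpow)
        finally have eq: "s powr ((real (k + i + 2) - 2 * x) - 1) = s ^ i * s powr (- x) * s powr (real k + 1 - x)" .
        have P: "s ^ i * s powr (- x) \<ge> 0" using s by simp
        have Q: "s powr (real k + 1 - x) \<ge> 0" by simp
        show ?thesis
          unfolding eq ennreal_mult[OF mult_nonneg_nonneg[OF P Q] le] ennreal_mult[OF P Q] ennreal_mult[OF d Q]
          by (simp only: mult_ac)
      qed
      hence "(\<Sum>i. ennreal (d k) * ennreal (s powr ((real (k + i + 2) - 2 * x) - 1) * ((u powr x - s powr x) / x))) =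
        (\<Sum>i. ennreal (s ^ i * s powr (- x)) * (ennreal ((u powr x - s powr x) / x) * ennreal (d k * s powr (real k + 1 - x))))"
        by (intro suminf_cong)
      also have "\<dots> = ennreal (s powr (- x) / (1 - s)) * (ennreal ((u powr x - s powr x) / x) * ennreal (d k * s powr (real k + 1 - x)))"
        unfolding C by (rule ennreal_suminf_multc)
      finally show ?thesis by (simp only: mult.assoc)
    qed
    hence "(\<Sum>k. \<Sum>i. ennreal (d k) * ennreal (s powr ((real (k + i + 2) - 2 * x) - 1) * ((u powr x - s powr x) / x)))
       = ennreal (s powr (- x) / (1 - s)) * ennreal ((u powr x - s powr x) / x) * (\<Sum>k. ennreal (d k * s powr (real k + 1 - x)))"
      by (simp only: ennreal_suminf_cmult)
    thus ?thesis using True by (simp only: indicator_simps mult_1_right)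
  qed auto
  have "(\<integral>\<^sup>+s. ennreal (s powr (- x) / (1 - s)) * ennreal ((u powr x - s powr x) / x) *
       (\<Sum>k. ennreal (d k * s powr (real k + 1 - x))) * indicator {0<..<u} s \<partial>lborel) =
     (\<Sum>k. \<Sum>i. ennreal (d k) * (\<integral>\<^sup>+s.
        (ennreal (s powr ((real (k + i + 2) - 2 * x) - 1) * ((u powr x - s powr x) / x)) * indicator {0<..<u} s) \<partial>lborel))"
    unfolding pw by (rule nn_integral_double_series) measurable
  also have "\<dots> = (\<Sum>k. \<Sum>i. ennreal (d k *
        (u powr (real (k + i + 2) - x) / ((real (k + i + 2) - 2 * x) * (real (k + i + 2) - x)))))"
  proof (intro suminf_cong)
    fix k i
    have "(\<integral>\<^sup>+s. (ennreal (s powr ((real (k + i + 2) - 2 * x) - 1) * ((u powr x - s powr x) / x)) * indicator {0<..<u} s) \<partial>lborel)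
       = ennreal (u powr (real (k + i + 2) - x) / ((real (k + i + 2) - 2 * x) * (real (k + i + 2) - x)))"
      using nn_integral_powr_diff[of x "real (k + i + 2) - 2 * x" u] x u by simp
    thus "ennreal (d k) * (\<integral>\<^sup>+s. (ennreal (s powr ((real (k + i + 2) - 2 * x) - 1) * ((u powr x - s powr x) / x)) * indicator {0<..<u} s) \<partial>lborel)
       = ennreal (d k * (u powr (real (k + i + 2) - x) / ((real (k + i + 2) - 2 * x) * (real (k + i + 2) - x))))"
      by (simp only: ennreal_mult'[OF d])
  qed
  finally show ?thesis unfolding d_def .
qed

text \<open>
  This identifies the quotient of factorials and Pochhammer symbols that the binomial coefficients
  and the Beta integral leave behind with the product in \<open>pair_gf\<close>.
\<close>

lemma prod_ratio_pochhammer: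
  fixes x :: real
  assumes "x < 1"
  shows "(\<Prod>j\<in>{Suc k..k + n}. real j / (real j - x)) =
    (fact (k + n) / fact k) * (pochhammer (1 - x) k / pochhammer (1 - x) (k + n))"
proof -
  have pos: "pochhammer (1 - x) m > 0" for m using assms by (intro pochhammer_pos) auto
  show ?thesis
  proof (induction n)
    case 0
    show ?case using pos[of k] by simp
  next
    case (Suc n)
    have "real (Suc (k + n)) - x > 0" using assms by simp
    hence P: "pochhammer (1 - x) (Suc (k + n)) = pochhammer (1 - x) (k + n) * (real (Suc (k + n)) - x)"
      by (simp add: pochhammer_Suc algebra_simps)
    have "(\<Prod>j\<in>{Suc k..k + Suc n}. real j / (real j - x)) =
       real (Suc (k + n)) / (real (Suc (k + n)) - x) * (\<Prod>j\<in>{Suc k..k + n}. real j / (real j - x))"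
    proof -
      have "{Suc k..k + Suc n} = insert (Suc (k + n)) {Suc k..k + n}" by auto
      thus ?thesis by simp
    qed
    moreover have "fact (k + Suc n) = real (Suc (k + n)) * fact (k + n)" by simp
    ultimately show ?case unfolding Suc.IH by (simp only: P add_Suc_right) (simp only: times_divide_times_eq mult_ac)
  qed
qed

text \<open>
  The powers of \<open>u\<close> combine to \<open>u\<^bsup>N - 1\<^esup>\<close> with \<open>N = k + i + 2\<close>, so each term is the Beta integral
  \<open>B(N, 1 - x)\<close>.
\<close>

lemma nn_integral_u2:
  fixes x :: real
  assumes x: "0 < x" "x \<le> 1/4"
  shows "(\<integral>\<^sup>+u. ennreal (u powr (x - 1) * (1 - u) powr (- x)) *
     (\<Sum>k. \<Sum>i. ennreal (pochhammer (1 - x) k / fact k / (real k + 1 - x) *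
        (u powr (real (k + i + 2) - x) / ((real (k + i + 2) - 2 * x) * (real (k + i + 2) - x))))) *
      indicator {0<..<1} u \<partial>lborel)
    = (\<Sum>k. \<Sum>i. ennreal (pair_gf x (Suc k, k + i + 2)))"
proof -
  define e where "e = (\<lambda>k i. pochhammer (1 - x) k / fact k / (real k + 1 - x) /
       ((real (k + i + 2) - 2 * x) * (real (k + i + 2) - x)))"
  have e: "e k i \<ge> 0" for k i
    using x by (auto simp: pochhammer_nonneg e_def intro!: divide_nonneg_nonneg mult_nonneg_nonneg)
  have pw: "ennreal (u powr (x - 1) * (1 - u) powr (- x)) *
     (\<Sum>k. \<Sum>i. ennreal (pochhammer (1 - x) k / fact k / (real k + 1 - x) *
        (u powr (real (k + i + 2) - x) / ((real (k + i + 2) - 2 * x) * (real (k + i + 2) - x))))) *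
      indicator {0<..<1} u =
     (\<Sum>k. \<Sum>i. ennreal (e k i) * (ennreal (u powr (real (k + i + 2) - 1) * (1 - u) powr (- x)) * indicator {0<..<1} u))" for u
  proof (cases "u \<in> {0<..<1}")
    case True
    hence u: "0 < u" "u < 1" by auto
    have "ennreal (u powr (x - 1) * (1 - u) powr (- x)) *
      ennreal (pochhammer (1 - x) k / fact k / (real k + 1 - x) *
        (u powr (real (k + i + 2) - x) / ((real (k + i + 2) - 2 * x) * (real (k + i + 2) - x)))) =
      ennreal (e k i) * ennreal (u powr (real (k + i + 2) - 1) * (1 - u) powr (- x))" for k i
    proof -
      have "u powr (real (k + i + 2) - 1) = u powr ((x - 1) + (real (k + i + 2) - x))" by simp
      also have "\<dots> = u powr (x - 1) * u powr (real (k + i + 2) - x)" by (rule powr_add)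
      finally have *: "u powr (real (k + i + 2) - 1) = u powr (x - 1) * u powr (real (k + i + 2) - x)" .
      have "pochhammer (1 - x) k / fact k / (real k + 1 - x) *
        (u powr (real (k + i + 2) - x) / ((real (k + i + 2) - 2 * x) * (real (k + i + 2) - x))) =
         e k i * u powr (real (k + i + 2) - x)" by (simp add: e_def)
      thus ?thesis using e unfolding * by (simp only: ennreal_mult[symmetric] mult_nonneg_nonneg powr_ge_zero) (simp add: mult_ac)
    qed
    hence "(\<Sum>k. \<Sum>i. ennreal (u powr (x - 1) * (1 - u) powr (- x)) *
      ennreal (pochhammer (1 - x) k / fact k / (real k + 1 - x) *
        (u powr (real (k + i + 2) - x) / ((real (k + i + 2) - 2 * x) * (real (k + i + 2) - x))))) =
      (\<Sum>k. \<Sum>i. ennreal (e k i) * ennreal (u powr (real (k + i + 2) - 1) * (1 - u) powr (- x)))"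
      by (intro suminf_cong)
    thus ?thesis using True by (simp only: ennreal_suminf_cmult indicator_simps mult_1_right)
  qed auto
  have "(\<integral>\<^sup>+u. (\<Sum>k. \<Sum>i. ennreal (e k i) * (ennreal (u powr (real (k + i + 2) - 1) * (1 - u) powr (- x)) * indicator {0<..<1} u)) \<partial>lborel)
    = (\<Sum>k. \<Sum>i. ennreal (e k i) * (\<integral>\<^sup>+u. (ennreal (u powr (real (k + i + 2) - 1) * (1 - u) powr (- x)) * indicator {0<..<1} u) \<partial>lborel))"
    by (rule nn_integral_double_series) measurable
  also have "\<dots> = (\<Sum>k. \<Sum>i. ennreal (pair_gf x (Suc k, k + i + 2)))"
  proof (intro suminf_cong)
    fix k i :: nat
    let ?N = "k + (i + 2)"
    have pos: "pochhammer (1 - x) m > 0" for m using x by (intro pochhammer_pos) auto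
    have fact: "fact ?N = real ?N * fact (?N - 1)"
      using fact_reduce[of ?N, where ?'a = real] by simp
    have "e k i * (fact (?N - 1) / pochhammer (1 - x) ?N) = pair_gf x (Suc k, ?N)"
      unfolding pair_gf_def prod.case
      by (subst prod_ratio_pochhammer) (use x pos[of k] pos[of ?N] in \<open>simp_all add: fact e_def divide_simps\<close>)
    moreover have "(\<integral>\<^sup>+u. (ennreal (u powr (real ?N - 1) * (1 - u) powr (- x)) * indicator {0<..<1} u) \<partial>lborel)
      = ennreal (fact (?N - 1) / pochhammer (1 - x) ?N)"
      by (rule nn_integral_beta) (use x in auto)
    ultimately show "ennreal (e k i) * (\<integral>\<^sup>+u. (ennreal (u powr (real (k + i + 2) - 1) * (1 - u) powr (- x)) * indicator {0<..<1} u) \<partial>lborel)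
        = ennreal (pair_gf x (Suc k, k + i + 2))"
      using e[of k i] pos[of ?N] by (simp only: add.assoc) (simp only: ennreal_mult'[symmetric])
  qed
  finally show ?thesis unfolding pw .
qed

section \<open>The generating function of the integrals\<close>

text \<open>
  Iterated integration with \<open>t\<^sub>1\<close> innermost, then \<open>t\<^sub>2\<close>, \<open>u\<^sub>1\<close>, \<open>u\<^sub>2\<close>. This order is the one of the
  coordinates, and each inner range \<open>(0, u\<^sub>1)\<close>, \<open>(u\<^sub>1, u\<^sub>2)\<close>, \<open>(0, u\<^sub>2)\<close> depends only on outer variables.
\<close>

lemma nn_integral_lborel_4:
  fixes f :: "real \<times> real \<times> real \<times> real \<Rightarrow> ennreal"
  assumes [measurable]: "f \<in> borel_measurable borel"
  shows "(\<integral>\<^sup>+z. f z \<partial>lborel) =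
    (\<integral>\<^sup>+u2. \<integral>\<^sup>+u1. \<integral>\<^sup>+t2. \<integral>\<^sup>+t1. f (t1, t2, u1, u2) \<partial>lborel \<partial>lborel \<partial>lborel \<partial>lborel)"
proof -
  have split: "(\<integral>\<^sup>+z. g z \<partial>lborel) = (\<integral>\<^sup>+y. \<integral>\<^sup>+x. g (x, y) \<partial>lborel \<partial>lborel)"
    if [measurable]: "g \<in> borel_measurable borel"
    for g :: "real \<times> 'b::euclidean_space \<Rightarrow> ennreal"
  proof -
    have "g \<in> borel_measurable (lborel \<Otimes>\<^sub>M lborel)" by (simp add: lborel_prod)
    from lborel_pair.nn_integral_snd[OF this] show ?thesis by (simp add: lborel_prod)
  qed
  have meas: "(\<lambda>y. \<integral>\<^sup>+x. g (x, y) \<partial>lborel) \<in> borel_measurable borel"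
    if [measurable]: "g \<in> borel_measurable borel"
    for g :: "real \<times> 'b::euclidean_space \<Rightarrow> ennreal"
  proof -
    have [measurable]: "g \<in> borel_measurable (borel \<Otimes>\<^sub>M borel)" by (simp add: borel_prod)
    show ?thesis by measurable
  qed
  show ?thesis
    by (subst split[OF assms], subst split[OF meas[OF assms]],
        subst split[OF meas[OF meas[OF assms]]]) (rule refl)
qed

definition J3_log :: "real \<times> real \<times> real \<times> real \<Rightarrow> real" where
  "J3_log = (\<lambda>(t1, t2, u1, u2). ln ((1 - t1) / (1 - u2)) + ln (t2 / t1) + ln (u2 / u1))"

definition J3_density :: "real \<times> real \<times> real \<times> real \<Rightarrow> real" where
  "J3_density = (\<lambda>(t1, t2, u1, u2). (1 / ((1 - t1) * t2)) * (1 / ((1 - u1) * u2)))"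

lemma J3_log_measurable [measurable]: "J3_log \<in> borel_measurable borel"
  and J3_density_measurable [measurable]: "J3_density \<in> borel_measurable borel"
  unfolding J3_log_def J3_density_def case_prod_unfold borel_prod[symmetric] by measurable

lemma D3_measurable [measurable]: "D3 \<in> sets borel"
proof -
  have "D3 = {z \<in> space borel. 0 < fst z \<and> fst z < fst (snd (snd z)) \<and> fst (snd (snd z)) < fst (snd z) \<and>
     fst (snd z) < snd (snd (snd z)) \<and> snd (snd (snd z)) < 1}"
    by (auto simp: D3_def)
  also have "\<dots> \<in> sets borel"
    unfolding borel_prod[symmetric] by measurable
  finally show ?thesis .
qed

lemma J3_log_nonneg: "z \<in> D3 \<Longrightarrow> J3_log z \<ge> 0"
  by (auto simp: D3_def J3_log_def intro!: add_nonneg_nonneg ln_ge_zero)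

lemma J3_density_nonneg: "z \<in> D3 \<Longrightarrow> J3_density z \<ge> 0"
  by (auto simp: D3_def J3_density_def)

text \<open>
  The same integral as an extended nonnegative number: it exists unconditionally and commutes with
  series, and its finiteness is a consequence of the final formula.
\<close>

definition J3_ennreal :: "nat \<Rightarrow> ennreal" where
  "J3_ennreal p = (\<integral>\<^sup>+z. ennreal (J3_log z ^ p / fact p * J3_density z) * indicator D3 z \<partial>lborel)"

lemma J3_eq_enn2real: "J3 p = enn2real (J3_ennreal p)"
proof -
  let ?f = "\<lambda>z. indicator D3 z * (J3_log z ^ p / fact p * J3_density z)"
  have "J3 p = 1 / fact p * (\<integral>z. indicator D3 z * (J3_log z ^ p * J3_density z) \<partial>lborel)"
    unfolding J3_def set_lebesgue_integral_def J3_log_def J3_density_def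
    by (simp add: case_prod_unfold mult.assoc)
  also have "\<dots> = (\<integral>z. 1 / fact p * (indicator D3 z * (J3_log z ^ p * J3_density z)) \<partial>lborel)"
    by (rule integral_mult_right_zero[symmetric])
  also have "\<dots> = (\<integral>z. ?f z \<partial>lborel)"
    by (simp add: field_simps)
  also have "\<dots> = enn2real (\<integral>\<^sup>+z. ennreal (?f z) \<partial>lborel)"
    by (rule integral_eq_nn_integral)
       (auto simp: indicator_def intro!: AE_I2 mult_nonneg_nonneg divide_nonneg_nonneg J3_log_nonneg J3_density_nonneg zero_le_power)
  also have "(\<integral>\<^sup>+z. ennreal (?f z) \<partial>lborel) = J3_ennreal p"
    unfolding J3_ennreal_def by (rule nn_integral_cong) (auto simp: indicator_def)
  finally show ?thesis .
qed

text \<open>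
  After summation over \<open>p\<close> the integrand factors into functions of one variable each.
\<close>

lemma exp_J3_log:
  assumes "(t1, t2, u1, u2) \<in> D3"
  shows "exp (x * J3_log (t1, t2, u1, u2)) * J3_density (t1, t2, u1, u2) =
    (u2 powr (x - 1) * (1 - u2) powr (- x)) * ((u1 powr (- x) / (1 - u1)) *
      (t2 powr (x - 1) * ((1 - t1) powr (x - 1) * t1 powr (- x))))"
proof -
  have pos: "0 < t1" "0 < u1" "0 < t2" "0 < u2" "0 < 1 - t1" "0 < 1 - u1" "0 < 1 - u2"
    using assms by (auto simp: D3_def)
  have "x * J3_log (t1, t2, u1, u2) = x * ln (1 - t1) + (- x) * ln (1 - u2) + x * ln t2 + (- x) * ln t1 + x * ln u2 + (- x) * ln u1"
    using pos by (simp add: J3_log_def ln_div algebra_simps)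
  hence "exp (x * J3_log (t1, t2, u1, u2)) = (1 - t1) powr x * (1 - u2) powr (- x) * t2 powr x * t1 powr (- x) * u2 powr x * u1 powr (- x)"
    using pos by (simp only: exp_add powr_def) simp
  thus ?thesis using pos by (simp add: J3_density_def powr_diff mult_ac)
qed

text \<open>
  By Tonelli the series over \<open>p\<close> moves under the integral, where it is an exponential series; then
  the variables are integrated out one after the other.
\<close>

lemma J3_ennreal_generating:
  fixes x :: real
  assumes x: "0 < x" "x \<le> 1/4"
  shows "(\<Sum>p. ennreal (x ^ p) * J3_ennreal p) = (\<Sum>k. \<Sum>i. ennreal (pair_gf x (Suc k, k + i + 2)))"
proof -
  let ?A = "\<lambda>t. ennreal ((1 - t) powr (x - 1) * t powr (- x))"
  let ?B = "\<lambda>t. ennreal (t powr (x - 1))"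
  let ?C = "\<lambda>u. ennreal (u powr (- x) / (1 - u))"
  let ?D = "\<lambda>u. ennreal (u powr (x - 1) * (1 - u) powr (- x))"
  let ?S1 = "\<lambda>u. \<Sum>k. ennreal (pochhammer (1 - x) k / fact k / (real k + 1 - x) * u powr (real k + 1 - x))"
  have "(\<Sum>p. ennreal (x ^ p) * J3_ennreal p) =
     (\<Sum>p. \<integral>\<^sup>+z. ennreal (x ^ p) * (ennreal (J3_log z ^ p / fact p * J3_density z) * indicator D3 z) \<partial>lborel)"
    unfolding J3_ennreal_def by (subst nn_integral_cmult) auto
  also have "\<dots> = (\<integral>\<^sup>+z. (\<Sum>p. ennreal (x ^ p) * (ennreal (J3_log z ^ p / fact p * J3_density z) * indicator D3 z)) \<partial>lborel)"
    by (rule nn_integral_suminf[symmetric]) auto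
  also have "\<dots> = (\<integral>\<^sup>+z. ennreal (exp (x * J3_log z) * J3_density z) * indicator D3 z \<partial>lborel)"
  proof (rule nn_integral_cong)
    fix z
    show "(\<Sum>p. ennreal (x ^ p) * (ennreal (J3_log z ^ p / fact p * J3_density z) * indicator D3 z)) =
       ennreal (exp (x * J3_log z) * J3_density z) * indicator D3 z"
    proof (cases "z \<in> D3")
      case True
      note nn = J3_log_nonneg[OF True] J3_density_nonneg[OF True]
      have "(\<lambda>p. (x * J3_log z) ^ p /\<^sub>R fact p * J3_density z) sums (exp (x * J3_log z) * J3_density z)"
        by (intro sums_mult2 exp_converges)
      hence "(\<Sum>p. ennreal ((x * J3_log z) ^ p /\<^sub>R fact p * J3_density z)) = ennreal (exp (x * J3_log z) * J3_density z)"
        using nn x by (intro suminf_ennreal_eq) auto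
      moreover have "ennreal ((x * J3_log z) ^ p /\<^sub>R fact p * J3_density z) =
         ennreal (x ^ p) * ennreal (J3_log z ^ p / fact p * J3_density z)" for p
        using nn x by (subst ennreal_mult[symmetric]) (auto simp: power_mult_distrib field_simps)
      ultimately show ?thesis using True by (simp only: indicator_simps mult_1_right)
    qed simp
  qed
  also have "\<dots> = (\<integral>\<^sup>+u2. \<integral>\<^sup>+u1. \<integral>\<^sup>+t2. \<integral>\<^sup>+t1.
      ennreal (exp (x * J3_log (t1, t2, u1, u2)) * J3_density (t1, t2, u1, u2)) * indicator D3 (t1, t2, u1, u2)
      \<partial>lborel \<partial>lborel \<partial>lborel \<partial>lborel)"
    by (rule nn_integral_lborel_4) measurable
  also have "\<dots> = (\<integral>\<^sup>+u2. \<integral>\<^sup>+u1. \<integral>\<^sup>+t2. \<integral>\<^sup>+t1.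
      (?D u2 * indicator {0<..<1} u2) * ((?C u1 * indicator {0<..<u2} u1) * ((?B t2 * indicator {u1<..<u2} t2) *
        (?A t1 * indicator {0<..<u1} t1))) \<partial>lborel \<partial>lborel \<partial>lborel \<partial>lborel)"
  proof (intro nn_integral_cong)
    fix u2 u1 t2 t1 :: real
    show "ennreal (exp (x * J3_log (t1, t2, u1, u2)) * J3_density (t1, t2, u1, u2)) * indicator D3 (t1, t2, u1, u2) =
      (?D u2 * indicator {0<..<1} u2) * ((?C u1 * indicator {0<..<u2} u1) * ((?B t2 * indicator {u1<..<u2} t2) *
        (?A t1 * indicator {0<..<u1} t1)))"
    proof (cases "(t1, t2, u1, u2) \<in> D3")
      case True
      hence "u2 \<in> {0<..<1}" "u1 \<in> {0<..<u2}" "t2 \<in> {u1<..<u2}" "t1 \<in> {0<..<u1}"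
        by (auto simp: D3_def)
      moreover have "ennreal (exp (x * J3_log (t1, t2, u1, u2)) * J3_density (t1, t2, u1, u2)) =
         ?D u2 * (?C u1 * (?B t2 * ?A t1))"
      proof -
        have "0 \<le> u2 powr (x - 1) * (1 - u2) powr (- x)" "0 \<le> u1 powr (- x) / (1 - u1)" "0 \<le> t2 powr (x - 1)"
          using True by (auto simp: D3_def)
        thus ?thesis unfolding exp_J3_log[OF True] by (simp only: ennreal_mult')
      qed
      ultimately show ?thesis using True by (simp only: indicator_simps mult_1_right)
    next
      case False
      hence "u2 \<notin> {0<..<1} \<or> u1 \<notin> {0<..<u2} \<or> t2 \<notin> {u1<..<u2} \<or> t1 \<notin> {0<..<u1}"
        by (auto simp: D3_def)
      thus ?thesis using False by (auto simp: indicator_def)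
    qed
  qed
  also have "\<dots> = (\<integral>\<^sup>+u2. \<integral>\<^sup>+u1. (?D u2 * indicator {0<..<1} u2) *
      (?C u1 * ennreal ((u2 powr x - u1 powr x) / x) * ?S1 u1 * indicator {0<..<u2} u1) \<partial>lborel \<partial>lborel)"
  proof (intro nn_integral_cong)
    fix u2 u1 :: real
    \<comment> \<open>With the outer variables fixed, the integrals over t1 and t2 are independent of each other.\<close>
    have "(\<integral>\<^sup>+t2. \<integral>\<^sup>+t1. (?D u2 * indicator {0<..<1} u2) * ((?C u1 * indicator {0<..<u2} u1) *
        ((?B t2 * indicator {u1<..<u2} t2) * (?A t1 * indicator {0<..<u1} t1))) \<partial>lborel \<partial>lborel) =
      (?D u2 * indicator {0<..<1} u2) * ((?C u1 * indicator {0<..<u2} u1) *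
        ((\<integral>\<^sup>+t2. ?B t2 * indicator {u1<..<u2} t2 \<partial>lborel) * (\<integral>\<^sup>+t1. ?A t1 * indicator {0<..<u1} t1 \<partial>lborel)))"
      by (subst nn_integral_cmult, measurable)+ (subst nn_integral_multc, measurable)
    also have "\<dots> = (?D u2 * indicator {0<..<1} u2) *
        (?C u1 * ennreal ((u2 powr x - u1 powr x) / x) * ?S1 u1 * indicator {0<..<u2} u1)"
    proof (cases "u2 \<in> {0<..<1} \<and> u1 \<in> {0<..<u2}")
      case True
      hence u1: "0 < u1" "u1 < 1" "u1 \<le> u2" "x < 1" using x by auto
      show ?thesis
        unfolding nn_integral_t1[OF x(1) u1(4) u1(1,2)] nn_integral_powr_between[OF x(1) u1(1,3)]
        using True by (simp only: indicator_simps mult_1_right mult.assoc)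
    next
      case False
      thus ?thesis by (auto simp: indicator_def)
    qed
    finally show "(\<integral>\<^sup>+t2. \<integral>\<^sup>+t1. (?D u2 * indicator {0<..<1} u2) * ((?C u1 * indicator {0<..<u2} u1) *
        ((?B t2 * indicator {u1<..<u2} t2) * (?A t1 * indicator {0<..<u1} t1))) \<partial>lborel \<partial>lborel) =
      (?D u2 * indicator {0<..<1} u2) *
        (?C u1 * ennreal ((u2 powr x - u1 powr x) / x) * ?S1 u1 * indicator {0<..<u2} u1)" .
  qed
  also have "\<dots> = (\<integral>\<^sup>+u2. (?D u2 * indicator {0<..<1} u2) *
      (\<Sum>k. \<Sum>i. ennreal (pochhammer (1 - x) k / fact k / (real k + 1 - x) *
        (u2 powr (real (k + i + 2) - x) / ((real (k + i + 2) - 2 * x) * (real (k + i + 2) - x))))) \<partial>lborel)"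
  proof (rule nn_integral_cong)
    fix u2 :: real
    let ?I = "\<integral>\<^sup>+u1. ?C u1 * ennreal ((u2 powr x - u1 powr x) / x) * ?S1 u1 * indicator {0<..<u2} u1 \<partial>lborel"
    have "(\<integral>\<^sup>+u1. (?D u2 * indicator {0<..<1} u2) *
        (?C u1 * ennreal ((u2 powr x - u1 powr x) / x) * ?S1 u1 * indicator {0<..<u2} u1) \<partial>lborel) =
        (?D u2 * indicator {0<..<1} u2) * ?I"
      by (rule nn_integral_cmult) measurable
    also have "\<dots> = (?D u2 * indicator {0<..<1} u2) *
      (\<Sum>k. \<Sum>i. ennreal (pochhammer (1 - x) k / fact k / (real k + 1 - x) *
        (u2 powr (real (k + i + 2) - x) / ((real (k + i + 2) - 2 * x) * (real (k + i + 2) - x)))))"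
    proof (cases "u2 \<in> {0<..<1}")
      case True
      hence u2: "0 < u2" "u2 < 1" by auto
      show ?thesis by (simp only: nn_integral_u1[OF x u2])
    qed simp
    finally show "(\<integral>\<^sup>+u1. (?D u2 * indicator {0<..<1} u2) *
        (?C u1 * ennreal ((u2 powr x - u1 powr x) / x) * ?S1 u1 * indicator {0<..<u2} u1) \<partial>lborel) =
      (?D u2 * indicator {0<..<1} u2) *
      (\<Sum>k. \<Sum>i. ennreal (pochhammer (1 - x) k / fact k / (real k + 1 - x) *
        (u2 powr (real (k + i + 2) - x) / ((real (k + i + 2) - 2 * x) * (real (k + i + 2) - x)))))" .
  qed
  also have "\<dots> = (\<integral>\<^sup>+u2. ?D u2 *
      (\<Sum>k. \<Sum>i. ennreal (pochhammer (1 - x) k / fact k / (real k + 1 - x) *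
        (u2 powr (real (k + i + 2) - x) / ((real (k + i + 2) - 2 * x) * (real (k + i + 2) - x))))) *
      indicator {0<..<1} u2 \<partial>lborel)"
    by (simp only: mult_ac)
  also have "\<dots> = (\<Sum>k. \<Sum>i. ennreal (pair_gf x (Suc k, k + i + 2)))"
    by (rule nn_integral_u2[OF x])
  finally show ?thesis .
qed

lemma suminf_pair_gf:
  fixes x :: real
  assumes x: "0 \<le> x" "x \<le> 1/4"
  shows "(\<Sum>k. \<Sum>i. ennreal (pair_gf x (Suc k, k + i + 2))) = ennreal (infsum (pair_gf x) pairs_less)"
proof -
  let ?h = "\<lambda>(k, i). pair_gf x (Suc k, k + i + 2)"
  have nonneg: "pair_gf x (Suc k, k + i + 2) \<ge> 0" for k i
    by (rule pair_gf_bounds[OF x]) auto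
  have "(pair_gf x has_sum infsum (pair_gf x) pairs_less) pairs_less"
    by (intro has_sum_infsum pair_gf_summable x)
  also have "?this \<longleftrightarrow> (?h has_sum infsum (pair_gf x) pairs_less) (UNIV \<times> UNIV)"
    by (rule has_sum_reindex_bij_witness[of _ "\<lambda>(k, i). (Suc k, k + i + 2)" "\<lambda>(k, l). (k - 1, l - k - 1)"])
       (auto simp: pairs_less_def numeral_2_eq_2 Suc_diff_Suc)
  finally have h: "(?h has_sum infsum (pair_gf x) pairs_less) (UNIV \<times> UNIV)" .
  define r where "r = (\<lambda>k. \<Sum>\<^sub>\<infinity>i. pair_gf x (Suc k, k + i + 2))"
  have row: "((\<lambda>i. pair_gf x (Suc k, k + i + 2)) has_sum r k) UNIV" for k
  proof -
    have "(\<lambda>(k, i). pair_gf x (Suc k, k + i + 2)) summable_on UNIV \<times> UNIV"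
      using h by (auto simp: summable_on_def)
    from summable_on_SigmaD1[OF this] show ?thesis unfolding r_def by (simp add: has_sum_infsum)
  qed
  have r: "(r has_sum infsum (pair_gf x) pairs_less) UNIV"
    using has_sum_SigmaD[OF h] row by simp
  have "(\<Sum>i. ennreal (pair_gf x (Suc k, k + i + 2))) = ennreal (r k)" for k
    using row nonneg by (intro suminf_ennreal_eq has_sum_imp_sums)
  moreover have "r k \<ge> 0" for k
    using row nonneg by (rule has_sum_nonneg)
  hence "(\<Sum>k. ennreal (r k)) = ennreal (infsum (pair_gf x) pairs_less)"
    by (intro suminf_ennreal_eq has_sum_imp_sums r)
  ultimately show ?thesis by simp
qed

text \<open>
  A convergent series of nonnegative terms has finite terms; this is how the integrability of all
  the integrands is obtained.
\<close>

lemma J3_sums: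
  fixes x :: real
  assumes x: "0 < x" "x \<le> 1/4"
  shows "(\<lambda>p. J3 p * x ^ p) sums infsum (pair_gf x) pairs_less"
proof -
  have eq: "(\<Sum>p. ennreal (x ^ p) * J3_ennreal p) = ennreal (infsum (pair_gf x) pairs_less)"
    using J3_ennreal_generating[OF x] suminf_pair_gf[of x] x by simp
  have fin: "J3_ennreal p < top" for p
  proof -
    have "ennreal (x ^ p) * J3_ennreal p \<noteq> top"
      using eq by (intro ennreal_suminf_lessD[of _ top, THEN less_imp_neq]) simp
    thus ?thesis using x by (auto simp: ennreal_mult_eq_top_iff top.not_eq_extremum)
  qed
  have nonneg: "J3 p \<ge> 0" for p by (simp add: J3_eq_enn2real)
  have "ennreal (x ^ p) * J3_ennreal p = ennreal (J3 p * x ^ p)" for p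
    using fin[of p] x nonneg[of p] by (simp add: J3_eq_enn2real ennreal_mult mult.commute)
  hence "(\<lambda>p. ennreal (J3 p * x ^ p)) sums ennreal (infsum (pair_gf x) pairs_less)"
    unfolding sums_iff using eq by simp
  moreover have "infsum (pair_gf x) pairs_less \<ge> 0"
    by (rule infsum_nonneg) (use x in \<open>auto simp: pairs_less_def intro!: pair_gf_bounds\<close>)
  ultimately show ?thesis using nonneg x by (subst (asm) sums_ennreal) auto
qed

section \<open>Comparison of coefficients\<close>

text \<open>
  Vanishing to the right of 0 suffices, because zeros of a nonzero power series are isolated. The
  proof multiplies the series by \<open>x\<close>, which forces the value 0 at the origin without touching
  the coefficients.
\<close>

lemma power_series_zero_right:
  fixes c :: "nat \<Rightarrow> real"
  assumes r: "0 < r" and zero: "\<And>x. 0 < x \<Longrightarrow> x \<le> r \<Longrightarrow> (\<lambda>n. c n * x ^ n) sums 0"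
  shows "c n = 0"
proof (rule ccontr)
  assume "c n \<noteq> 0"
  define a where "a = (\<lambda>n. case n of 0 \<Rightarrow> 0 | Suc m \<Rightarrow> c m)"
  define f where "f = (\<lambda>x. x * (\<Sum>n. c n * x ^ n))"
  have sums: "(\<lambda>n. a n * (x - 0) ^ n) sums f x" if "norm (x - 0) < r" for x
  proof -
    have "summable (\<lambda>n. c n * x ^ n)"
      by (rule powser_inside[of _ r]) (use zero[of r] r that in \<open>auto simp: sums_iff\<close>)
    hence "(\<lambda>n. x * (c n * x ^ n)) sums f x"
      unfolding f_def by (intro sums_mult summable_sums)
    hence "(\<lambda>n. a (Suc n) * (x - 0) ^ Suc n) sums f x"
      by (simp add: a_def mult_ac)
    thus ?thesis by (subst (asm) sums_Suc_iff) (simp add: a_def)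
  qed
  have "f 0 = 0" "a (Suc n) \<noteq> 0" using \<open>c n \<noteq> 0\<close> by (auto simp: f_def a_def)
  from powser_0_nonzero[OF r sums this] obtain s
    where s: "0 < s" "\<And>z. z \<in> cball 0 s - {0} \<Longrightarrow> f z \<noteq> 0" by auto
  have "f (min r s) = 0" using zero[of "min r s"] r s(1) by (auto simp: f_def sums_iff)
  moreover have "f (min r s) \<noteq> 0" using r s(1) by (intro s(2)) auto
  ultimately show False by contradiction
qed

theorem corollary7p2:
  fixes p :: nat
  shows "J3 p =
    (\<Sum>(m, n) | m + n = p.
      \<Sum>(\<alpha>\<^sub>1, \<alpha>\<^sub>2) | 1 \<le> \<alpha>\<^sub>1 \<and> 1 \<le> \<alpha>\<^sub>2 \<and> \<alpha>\<^sub>1 + \<alpha>\<^sub>2 = n + 3.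
        (zeta_star ([\<alpha>\<^sub>1] @ replicate m 1 @ [\<alpha>\<^sub>2 + 1]) - zeta_value (p + 4)) * (2 ^ (\<alpha>\<^sub>2 - 1) - 1))"
proof -
  have "J3 p - star_side p = 0"
  proof (rule power_series_zero_right[of "1/4" "\<lambda>p. J3 p - star_side p"])
    fix x :: real assume x: "0 < x" "x \<le> 1/4"
    have "(\<lambda>p. J3 p * x ^ p - star_side p * x ^ p) sums
        (infsum (pair_gf x) pairs_less - infsum (pair_gf x) pairs_less)"
      by (intro sums_diff J3_sums star_side_sums) (use x in auto)
    thus "(\<lambda>p. (J3 p - star_side p) * x ^ p) sums 0"
      by (simp add: left_diff_distrib)
  qed simp
  thus ?thesis by (simp add: star_side_def)
qed

end
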